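(* Let $\Sigma$ be a relational schema, $q$ a Boolean conjunctive query over $\Sigma$, $D$ a database over $\Sigma$, and $K$ a key component of $D$. Let $H_D=\langle D,E\rangle$, with $E = E_q\cup E_\kappa$, be the conflict-join hypergraph of $D$ (w.r.t. $q$ and $\Sigma$). If $K \setminus \bigcup_{e \in E_q} e \neq \emptyset$, then $K$ is redundant (w.r.t. $q$).
   Context: Fix disjoint countably infinite sets $\mathbf{C}$ (constants) and $\mathbf{V}$ (variables). A relational schema is a triple $\Sigma=\langle \mathcal{R},\alpha,\kappa\rangle$ with $\mathcal{R}$ a finite set of relation symbols, $\alpha:\mathcal{R}\to\mathbb{N}$ giving arities, and $\kappa$ assigning to each $r\in\mathcal{R}$ a nonempty set $\kappa(r)\subseteq\{1,\ldots,\alpha(r)\}$ (the primary key positions). An atom is $r(t_1,\ldots,t_{\alpha(r)})$ with terms $t_i\in\mathbf{C}\cup\mathbf{V}$; it is a fact if all terms are constants. A database is a finite set of facts. For an atom $r(\mathbf{t})$, $\hat{\mathbf{t}}$ is the subsequence of $\mathbf{t}$ at the positions in $\kappa(r)$. A database is inconsistent if it contains two different facts $r(\mathbf{t}_1),r(\mathbf{t}_2)$ with $\hat{\mathbf{t}}_1=\hat{\mathbf{t}}_2$; otherwise it is consistent. A repair of $D$ is a maximal (w.r.t. inclusion) consistent subset of $D$. A substitution is a map $\mu:\mathbf{C}\cup\mathbf{V}\to\mathbf{C}\cup\mathbf{V}$ that is the identity on $\mathbf{C}$, extended to (sets of) atoms termwise. A Boolean conjunctive query (BCQ) $q$ is an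 existentially closed conjunction of atoms (possibly with constants), identified with the set of its atoms. $q$ is true in a database $R$ if $\mu(q)\subseteq R$ for some substitution $\mu$. $D\models_\Sigma q$ ("$q$ is consistently true in $D$") means that $q$ is true in every repair of $D$. A key component of $D$ is a maximal subset $K\subseteq D$ such that any two facts $r_1(\mathbf{t}_1),r_2(\mathbf{t}_2)\in K$ satisfy $r_1=r_2$ and $\hat{\mathbf{t}}_1=\hat{\mathbf{t}}_2$; the set of all key components of $D$ is denoted $\mathit{comp}(D,\Sigma)$. Let $\mathit{var}(q)$ be the set of variables of $q$ and $\mathit{sub}(q,D)=\{\mu|_{\mathit{var}(q)} : \mu \text{ is a substitution and } \mu(q)\subseteq D\}$. The conflict-join hypergraph of $D$ (w.r.t. $q$ and $\Sigma$) is $H_D=\langle D,E\rangle$, with vertex set $D$ and hyperedge set $E=E_q\cup E_\kappa$, where $E_q=\{\mu(q):\mu\in\mathit{sub}(q,D)\}$ and $E_\kappa=\mathit{comp}(D,\Sigma)$. A fragment of $D$ is any set of the form $\bigcup_{K\in C}K$ with $C\subseteq \mathit{comp}(D,\Sigma)$. A key component $K$ of $D$ is redundant (w.r.t. $q$) if for each fragment $F$ of $D$, $F\models_\Sigma q$ implies $F\setminus K\models_\Sigma q$. *)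

theory Defs
  imports Main "HOL-Library.FuncSet" "HOL-Library.Countable" "HOL-Library.Infinite_Typeclass"
begin

record 'r schema =
  rels :: "'r set"
  arity :: "'r \<Rightarrow> nat"
  pkey :: "'r \<Rightarrow> nat set"

definition wf_schema :: "'r schema \<Rightarrow> bool" where
  "wf_schema \<Sigma> \<longleftrightarrow> finite (rels \<Sigma>) \<and>
     (\<forall>r \<in> rels \<Sigma>. pkey \<Sigma> r \<noteq> {} \<and> pkey \<Sigma> r \<subseteq> {1..arity \<Sigma> r})"

datatype ('c, 'v) trm = Const 'c | Var 'v

datatype ('r, 'c, 'v) atom = Atom (rel: 'r) (args: "('c, 'v) trm list")

definition atom_over :: "'r schema \<Rightarrow> ('r, 'c, 'v) atom \<Rightarrow> bool" where
  "atom_over \<Sigma> a \<longleftrightarrow> rel a \<in> rels \<Sigma> \<and> length (args a) = arity \<Sigma> (rel a)"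

definition is_fact :: "('r, 'c, 'v) atom \<Rightarrow> bool" where
  "is_fact a \<longleftrightarrow> set (args a) \<subseteq> range Const"

definition database :: "'r schema \<Rightarrow> ('r, 'c, 'v) atom set \<Rightarrow> bool" where
  "database \<Sigma> D \<longleftrightarrow> finite D \<and> (\<forall>a \<in> D. atom_over \<Sigma> a \<and> is_fact a)"

(* Key positions count from 1, list indices from 0. *)
definition key_args :: "'r schema \<Rightarrow> ('r, 'c, 'v) atom \<Rightarrow> ('c, 'v) trm list" where
  "key_args \<Sigma> a = nths (args a) {i. Suc i \<in> pkey \<Sigma> (rel a)}"

definition consistent :: "'r schema \<Rightarrow> ('r, 'c, 'v) atom set \<Rightarrow> bool" where
  "consistent \<Sigma> D \<longleftrightarrow>
     \<not> (\<exists>a \<in> D. \<exists>b \<in> D. a \<noteq> b \<and> rel a = rel b \<and> key_args \<Sigma> a = key_args \<Sigma> b)"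

definition repair ::
  "'r schema \<Rightarrow> ('r, 'c, 'v) atom set \<Rightarrow> ('r, 'c, 'v) atom set \<Rightarrow> bool" where
  "repair \<Sigma> D R \<longleftrightarrow> R \<subseteq> D \<and> consistent \<Sigma> R \<and>
     (\<forall>R'. R \<subseteq> R' \<and> R' \<subseteq> D \<and> consistent \<Sigma> R' \<longrightarrow> R' = R)"

(* A substitution fixes all constants, so it is given by its values on variables. *)
type_synonym ('c, 'v) subst = "'v \<Rightarrow> ('c, 'v) trm"

fun subst_trm :: "('c, 'v) subst \<Rightarrow> ('c, 'v) trm \<Rightarrow> ('c, 'v) trm" where
  "subst_trm \<mu> (Const c) = Const c"
| "subst_trm \<mu> (Var x) = \<mu> x"

definition subst_atom :: "('c, 'v) subst \<Rightarrow> ('r, 'c, 'v) atom \<Rightarrow> ('r, 'c, 'v) atom" where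
  "subst_atom \<mu> a = Atom (rel a) (map (subst_trm \<mu>) (args a))"

(* A Boolean conjunctive query is identified with its finite set of atoms, all of whose
   variables are existentially quantified. *)
definition bcq :: "'r schema \<Rightarrow> ('r, 'c, 'v) atom set \<Rightarrow> bool" where
  "bcq \<Sigma> q \<longleftrightarrow> finite q \<and> (\<forall>a \<in> q. atom_over \<Sigma> a)"

definition vars :: "('r, 'c, 'v) atom set \<Rightarrow> 'v set" where
  "vars q = {x. \<exists>a \<in> q. Var x \<in> set (args a)}"

definition true_in :: "('r, 'c, 'v) atom set \<Rightarrow> ('r, 'c, 'v) atom set \<Rightarrow> bool" where
  "true_in R q \<longleftrightarrow> (\<exists>\<mu>. subst_atom \<mu> ` q \<subseteq> R)"

definition consistently_true ::
  "'r schema \<Rightarrow> ('r, 'c, 'v) atom set \<Rightarrow> ('r, 'c, 'v) atom set \<Rightarrow> bool" where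
  "consistently_true \<Sigma> D q \<longleftrightarrow> (\<forall>R. repair \<Sigma> D R \<longrightarrow> true_in R q)"

definition same_key :: "'r schema \<Rightarrow> ('r, 'c, 'v) atom set \<Rightarrow> bool" where
  "same_key \<Sigma> K \<longleftrightarrow> (\<forall>a \<in> K. \<forall>b \<in> K. rel a = rel b \<and> key_args \<Sigma> a = key_args \<Sigma> b)"

definition key_components ::
  "'r schema \<Rightarrow> ('r, 'c, 'v) atom set \<Rightarrow> ('r, 'c, 'v) atom set set" where
  "key_components \<Sigma> D = {K. K \<subseteq> D \<and> same_key \<Sigma> K \<and>
     (\<forall>K'. K \<subseteq> K' \<and> K' \<subseteq> D \<and> same_key \<Sigma> K' \<longrightarrow> K' = K)}"

(* Values outside the variables of q do not affect the image of q. *)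
definition sub :: "('r, 'c, 'v) atom set \<Rightarrow> ('r, 'c, 'v) atom set \<Rightarrow> ('c, 'v) subst set" where
  "sub q D = {restrict \<mu> (vars q) | \<mu>. subst_atom \<mu> ` q \<subseteq> D}"

definition join_edges ::
  "('r, 'c, 'v) atom set \<Rightarrow> ('r, 'c, 'v) atom set \<Rightarrow> ('r, 'c, 'v) atom set set" where
  "join_edges q D = {subst_atom \<mu> ` q | \<mu>. \<mu> \<in> sub q D}"

definition conflict_join_hypergraph ::
  "'r schema \<Rightarrow> ('r, 'c, 'v) atom set \<Rightarrow> ('r, 'c, 'v) atom set \<Rightarrow>
     ('r, 'c, 'v) atom set \<times> ('r, 'c, 'v) atom set set" where
  "conflict_join_hypergraph \<Sigma> q D = (D, join_edges q D \<union> key_components \<Sigma> D)"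

definition fragment ::
  "'r schema \<Rightarrow> ('r, 'c, 'v) atom set \<Rightarrow> ('r, 'c, 'v) atom set \<Rightarrow> bool" where
  "fragment \<Sigma> D F \<longleftrightarrow> (\<exists>C. C \<subseteq> key_components \<Sigma> D \<and> F = \<Union>C)"

definition redundant ::
  "'r schema \<Rightarrow> ('r, 'c, 'v) atom set \<Rightarrow> ('r, 'c, 'v) atom set \<Rightarrow> ('r, 'c, 'v) atom set \<Rightarrow> bool" where
  "redundant \<Sigma> q D K \<longleftrightarrow>
     (\<forall>F. fragment \<Sigma> D F \<and> consistently_true \<Sigma> F q \<longrightarrow> consistently_true \<Sigma> (F - K) q)"

end

theory Submission
  imports Defs
begin

text \<open>Pick a fact \<open>a\<close> of \<open>K\<close> that lies on no join edge. If a fragment \<open>F\<close> contains \<open>K\<close>, then every repair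
  \<open>R\<close> of \<open>F - K\<close> extends to the repair \<open>insert a R\<close> of \<open>F\<close>. A match of \<open>q\<close> in \<open>insert a R\<close> is a
  join edge, hence avoids \<open>a\<close> and is already a match in \<open>R\<close>.\<close>

text \<open>The right-hand side satisfies \<open>same_key\<close> and contains \<open>K\<close>, so
  maximality of \<open>K\<close> forces equality. Hence any single member determines its key
  component.\<close>

lemma key_component_eq:
  assumes "K \<in> key_components \<Sigma> D" and "a \<in> K"
  shows "K = {b \<in> D. rel b = rel a \<and> key_args \<Sigma> b = key_args \<Sigma> a}"
    (is "K = ?B")
proof -
  have K: "K \<subseteq> D" "same_key \<Sigma> K"
      "\<And>K'. K \<subseteq> K' \<Longrightarrow> K' \<subseteq> D \<Longrightarrow> same_key \<Sigma> K' \<Longrightarrow> K' = K"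
    using assms(1) by (auto simp: key_components_def)
  have "K \<subseteq> ?B"
    using K(1,2) assms(2) unfolding same_key_def by blast
  moreover have "?B \<subseteq> D" "same_key \<Sigma> ?B"
    by (auto simp: same_key_def)
  ultimately show ?thesis
    using K(3) by blast
qed

lemma fragment_subset: "fragment \<Sigma> D F \<Longrightarrow> F \<subseteq> D"
  by (auto simp: fragment_def key_components_def)

text \<open>Key components that share a fact coincide, so a fragment meeting \<open>K\<close> must
  have \<open>K\<close> among the components it is a union of.\<close>

lemma key_component_subset_fragment:
  assumes "fragment \<Sigma> D F" and "K \<in> key_components \<Sigma> D" and "K \<inter> F \<noteq> {}"
  shows "K \<subseteq> F"
proof -
  obtain C where C: "C \<subseteq> key_components \<Sigma> D" "F = \<Union>C"
    using assms(1) by (auto simp: fragment_def)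
  obtain b K' where b: "b \<in> K" "b \<in> K'" "K' \<in> C"
    using assms(3) C(2) by blast
  then have "K = K'"
    using key_component_eq assms(2) C(1) by blast
  then show ?thesis
    using b(3) C(2) by blast
qed

lemma repair_insert:
  assumes K: "K \<in> key_components \<Sigma> D" and "a \<in> K" and "a \<in> F" and "F \<subseteq> D"
    and "repair \<Sigma> (F - K) R"
  shows "repair \<Sigma> F (insert a R)"
proof -
  have R: "R \<subseteq> F - K" "consistent \<Sigma> R"
      "\<And>R'. R \<subseteq> R' \<Longrightarrow> R' \<subseteq> F - K \<Longrightarrow> consistent \<Sigma> R' \<Longrightarrow> R' = R"
    using assms(5) by (auto simp: repair_def)
  have in_K: "b \<in> K \<longleftrightarrow> rel b = rel a \<and> key_args \<Sigma> b = key_args \<Sigma> a" if "b \<in> F" for b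
    using key_component_eq[OF K \<open>a \<in> K\<close>] that \<open>F \<subseteq> D\<close> by blast
  \<comment> \<open>Since \<open>R\<close> avoids \<open>K\<close>, none of its facts can conflict
    with \<open>a\<close>.\<close>
  have "\<not> (rel b = rel a \<and> key_args \<Sigma> b = key_args \<Sigma> a)" if "b \<in> R" for b
    using in_K R(1) that by blast
  then have "consistent \<Sigma> (insert a R)"
    using R(2) unfolding consistent_def by (metis insert_iff)
  moreover have "R' = insert a R"
    if "insert a R \<subseteq> R'" "R' \<subseteq> F" "consistent \<Sigma> R'" for R'
  proof -
    \<comment> \<open>Every fact of \<open>K\<close> has the key of \<open>a\<close>, so a
      consistent \<open>R'\<close> containing \<open>a\<close> has no other fact of
      \<open>K\<close>. Deleting \<open>a\<close> therefore brings \<open>R'\<close> back into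
      \<open>F - K\<close>, where maximality of \<open>R\<close> applies.\<close>
    have "b = a" if "b \<in> R'" "b \<in> K" for b
    proof -
      have "rel b = rel a" "key_args \<Sigma> b = key_args \<Sigma> a"
        using in_K that \<open>R' \<subseteq> F\<close> by blast+
      then show ?thesis
        using \<open>consistent \<Sigma> R'\<close> \<open>insert a R \<subseteq> R'\<close> \<open>b \<in> R'\<close> unfolding consistent_def by blast
    qed
    then have "R' - {a} \<subseteq> F - K"
      using \<open>R' \<subseteq> F\<close> by blast
    moreover have "R \<subseteq> R' - {a}"
      using R(1) \<open>a \<in> K\<close> \<open>insert a R \<subseteq> R'\<close> by blast
    moreover have "consistent \<Sigma> (R' - {a})"
      using \<open>consistent \<Sigma> R'\<close> unfolding consistent_def by blast
    ultimately have "R' - {a} = R"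
      using R(3) by blast
    then show ?thesis
      using \<open>insert a R \<subseteq> R'\<close> by blast
  qed
  ultimately show ?thesis
    using R(1) \<open>a \<in> F\<close> unfolding repair_def by blast
qed

lemma subst_trm_cong:
  assumes "\<And>x. t = Var x \<Longrightarrow> \<mu> x = \<nu> x"
  shows "subst_trm \<mu> t = subst_trm \<nu> t"
  using assms by (cases t) auto

text \<open>Outside \<open>vars q\<close> the restricted substitution is \<open>undefined\<close>,
  but no variable of an atom of \<open>q\<close> lies there.\<close>

lemma subst_atom_restrict:
  assumes "a \<in> q"
  shows "subst_atom (restrict \<mu> (vars q)) a = subst_atom \<mu> a"
  using assms by (auto simp: subst_atom_def vars_def intro!: subst_trm_cong)

text \<open>Join edges are defined through restricted substitutions; this allows an arbitrary match
  of \<open>q\<close> to be used directly.\<close>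

lemma image_in_join_edges:
  assumes "subst_atom \<mu> ` q \<subseteq> D"
  shows "subst_atom \<mu> ` q \<in> join_edges q D"
proof -
  have "restrict \<mu> (vars q) \<in> sub q D"
    using assms by (auto simp: sub_def)
  moreover have "subst_atom \<mu> ` q = subst_atom (restrict \<mu> (vars q)) ` q"
    by (rule image_cong) (auto simp: subst_atom_restrict)
  ultimately show ?thesis
    unfolding join_edges_def by blast
qed

theorem theorem2:
  fixes \<Sigma> :: "'r schema"
    and q D K :: "('r, 'c::{countable,infinite}, 'v::{countable,infinite}) atom set"
    and E\<^sub>q E\<^sub>\<kappa> :: "('r, 'c, 'v) atom set set"
  assumes "wf_schema \<Sigma>"
    and "bcq \<Sigma> q"
    and "database \<Sigma> D"
    and "K \<in> key_components \<Sigma> D"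
    and "E\<^sub>q = join_edges q D"
    and "E\<^sub>\<kappa> = key_components \<Sigma> D"
    and "conflict_join_hypergraph \<Sigma> q D = (D, E\<^sub>q \<union> E\<^sub>\<kappa>)"
    and "K - \<Union>E\<^sub>q \<noteq> {}"
  shows "redundant \<Sigma> q D K"
proof -
  obtain a where a: "a \<in> K" "a \<notin> \<Union>(join_edges q D)"
    using assms(5,8) by blast
  have "true_in R q"
    if F: "fragment \<Sigma> D F" "consistently_true \<Sigma> F q" and R: "repair \<Sigma> (F - K) R" for F R
  proof (cases "K \<inter> F = {}")
    \<comment> \<open>Here \<open>a\<close> is not in \<open>F\<close>, but removing
      \<open>K\<close> changes nothing, so \<open>R\<close> is already a repair of
      \<open>F\<close>.\<close>
    case True
    then have "F - K = F"
      by blast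
    then show ?thesis
      using F(2) R by (simp add: consistently_true_def)
  next
    case False
    then have "a \<in> F"
      using key_component_subset_fragment[OF F(1) assms(4)] a(1) by blast
    have "F \<subseteq> D"
      using F(1) by (rule fragment_subset)
    have rep: "repair \<Sigma> F (insert a R)"
      using assms(4) a(1) \<open>a \<in> F\<close> \<open>F \<subseteq> D\<close> R by (rule repair_insert)
    then have "true_in (insert a R) q"
      using F(2) by (simp add: consistently_true_def)
    then obtain \<mu> where \<mu>: "subst_atom \<mu> ` q \<subseteq> insert a R"
      by (auto simp: true_in_def)
    moreover have "insert a R \<subseteq> F"
      using rep by (simp add: repair_def)
    \<comment> \<open>The hypothesis on \<open>a\<close> concerns join edges of the whole of
      \<open>D\<close>, so the match is viewed as one in \<open>D\<close>.\<close>
    ultimately have "subst_atom \<mu> ` q \<in> join_edges q D"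
      using \<open>F \<subseteq> D\<close> by (intro image_in_join_edges) blast
    then have "subst_atom \<mu> ` q \<subseteq> R"
      using \<mu> a(2) by blast
    then show ?thesis
      unfolding true_in_def by blast
  qed
  then show ?thesis
    unfolding redundant_def consistently_true_def by blast
qed

end
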